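(* Every finite nilpotent group of class $2$ is an IYB group.
   Context: $\mathrm{Fa}_n$ is the free abelian group (written multiplicatively) with basis $u_1,\dots,u_n$, and $\mathrm{Fa}_n\rtimes \mathrm{Sym}_n$ is the semidirect product for the natural action $\sigma(u_i)=u_{\sigma(i)}$, where $\mathrm{Sym}_n$ is the symmetric group of degree $n$. A finite group $G$ is an involutive Yang-Baxter (IYB) group if for some positive integer $n$ there is a map $\phi:\mathrm{Fa}_n\to \mathrm{Sym}_n$ such that $\{(a,\phi(a)) : a\in \mathrm{Fa}_n\}$ is a subgroup of $\mathrm{Fa}_n\rtimes \mathrm{Sym}_n$ and $G\cong\phi(\mathrm{Fa}_n)$. *)

theory Defs
  imports "HOL-Algebra.Sym_Groups" "HOL-Algebra.Free_Abelian_Groups"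
begin

definition semidirect_product ::
    "('a, 'c) monoid_scheme \<Rightarrow> ('b, 'd) monoid_scheme \<Rightarrow> ('b \<Rightarrow> 'a \<Rightarrow> 'a) \<Rightarrow> ('a \<times> 'b) monoid" where
  "semidirect_product N H \<theta> =
     \<lparr> carrier = carrier N \<times> carrier H,
       mult = (\<lambda>(a, s) (b, t). (a \<otimes>\<^bsub>N\<^esub> \<theta> s b, s \<otimes>\<^bsub>H\<^esub> t)),
       one = (\<one>\<^bsub>N\<^esub>, \<one>\<^bsub>H\<^esub>) \<rparr>"

text \<open>The library writes free abelian groups additively; the basis element \<open>u\<^sub>i\<close> is \<open>frag_of i\<close>.\<close>

definition Fa :: "nat \<Rightarrow> (nat \<Rightarrow>\<^sub>0 int) monoid" where
  "Fa n = free_Abelian_group {1..n}"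

text \<open>The natural action: \<open>frag_extend\<close> extends \<open>u\<^sub>i \<mapsto> u\<^bsub>\<sigma>(i)\<^esub>\<close> additively.\<close>

definition perm_action :: "(nat \<Rightarrow> nat) \<Rightarrow> (nat \<Rightarrow>\<^sub>0 int) \<Rightarrow> (nat \<Rightarrow>\<^sub>0 int)" where
  "perm_action \<sigma> = frag_extend (\<lambda>i. frag_of (\<sigma> i))"

definition Fa_Sym :: "nat \<Rightarrow> ((nat \<Rightarrow>\<^sub>0 int) \<times> (nat \<Rightarrow> nat)) monoid" where
  "Fa_Sym n = semidirect_product (Fa n) (sym_group n) perm_action"

definition IYB_group :: "('a, 'b) monoid_scheme \<Rightarrow> bool" where
  "IYB_group G \<longleftrightarrow>
     group G \<and> finite (carrier G) \<and>
     (\<exists>n>0. \<exists>\<phi> \<in> carrier (Fa n) \<rightarrow> carrier (sym_group n).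
        subgroup {(a, \<phi> a) | a. a \<in> carrier (Fa n)} (Fa_Sym n) \<and>
        G \<cong> (sym_group n)\<lparr>carrier := \<phi> ` carrier (Fa n)\<rparr>)"

text \<open>Indexing from 0: \<open>lower_central G k\<close> is the term usually written \<open>\<gamma>\<^bsub>k+1\<^esub>(G)\<close>.\<close>

primrec lower_central :: "('a, 'b) monoid_scheme \<Rightarrow> nat \<Rightarrow> 'a set" where
  "lower_central G 0 = carrier G"
| "lower_central G (Suc k) =
     generate G {x \<otimes>\<^bsub>G\<^esub> y \<otimes>\<^bsub>G\<^esub> inv\<^bsub>G\<^esub> x \<otimes>\<^bsub>G\<^esub> inv\<^bsub>G\<^esub> y | x y. x \<in> lower_central G k \<and> y \<in> carrier G}"

definition nilpotent_group :: "('a, 'b) monoid_scheme \<Rightarrow> bool" where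
  "nilpotent_group G \<longleftrightarrow> group G \<and> (\<exists>k. lower_central G k = {\<one>\<^bsub>G\<^esub>})"

text \<open>Meaningful for nilpotent groups only.\<close>

definition nilpotency_class :: "('a, 'b) monoid_scheme \<Rightarrow> nat" where
  "nilpotency_class G = (LEAST k. lower_central G k = {\<one>\<^bsub>G\<^esub>})"


lemma perm_action_basis: "perm_action \<sigma> (frag_of i) = frag_of (\<sigma> i)"
  by (simp add: perm_action_def)

lemma perm_action_add: "perm_action \<sigma> (a + b) = perm_action \<sigma> a + perm_action \<sigma> b"
  by (simp add: perm_action_def frag_extend_add)

lemma perm_action_comp: "perm_action (\<sigma> \<circ> \<tau>) a = perm_action \<sigma> (perm_action \<tau> a)"
  by (rule frag_induction[of a UNIV]) (simp_all add: perm_action_def frag_extend_diff)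

lemma perm_action_id: "perm_action id a = a"
  by (rule frag_induction[of a UNIV]) (simp_all add: perm_action_def frag_extend_diff)

lemma perm_action_closed:
  assumes "\<sigma> \<in> carrier (sym_group n)" "a \<in> carrier (Fa n)"
  shows "perm_action \<sigma> a \<in> carrier (Fa n)"
proof -
  have s: "\<sigma> permutes {1..n}" and a: "Poly_Mapping.keys a \<subseteq> {1..n}"
    using assms by (simp_all add: sym_group_carrier Fa_def)
  have "Poly_Mapping.keys (perm_action \<sigma> a) \<subseteq> {1..n}"
    using a
  proof (induction a rule: frag_induction)
    case (one x)
    then show ?case using permutes_in_image[OF s] by (simp add: perm_action_basis)
  next
    case (diff a b)
    then show ?case
      using keys_diff[of "perm_action \<sigma> a" "perm_action \<sigma> b"]
      by (auto simp: perm_action_def frag_extend_diff)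
  qed (simp add: perm_action_def)
  then show ?thesis by (simp add: Fa_def)
qed

lemma Fa_Sym_group: "group (Fa_Sym n)"
proof (rule groupI)
  interpret S: group "sym_group n" by (rule sym_group_is_group)
  interpret F: group "Fa n" by (simp add: Fa_def)
  note defs = Fa_Sym_def semidirect_product_def
  have F_mult: "a \<otimes>\<^bsub>Fa n\<^esub> b = a + b" and F_one: "\<one>\<^bsub>Fa n\<^esub> = 0" for a b
    by (simp_all add: Fa_def)
  show "x \<otimes>\<^bsub>Fa_Sym n\<^esub> y \<in> carrier (Fa_Sym n)"
    if "x \<in> carrier (Fa_Sym n)" "y \<in> carrier (Fa_Sym n)" for x y
    using that by (auto simp: defs perm_action_closed)
  show "\<one>\<^bsub>Fa_Sym n\<^esub> \<in> carrier (Fa_Sym n)"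
    by (simp add: defs)
  show "x \<otimes>\<^bsub>Fa_Sym n\<^esub> y \<otimes>\<^bsub>Fa_Sym n\<^esub> z = x \<otimes>\<^bsub>Fa_Sym n\<^esub> (y \<otimes>\<^bsub>Fa_Sym n\<^esub> z)"
    if "x \<in> carrier (Fa_Sym n)" "y \<in> carrier (Fa_Sym n)" "z \<in> carrier (Fa_Sym n)" for x y z
    using that
    by (auto simp: defs F_mult perm_action_add perm_action_comp sym_group_mult add.assoc comp_assoc)
  show "\<one>\<^bsub>Fa_Sym n\<^esub> \<otimes>\<^bsub>Fa_Sym n\<^esub> x = x" if "x \<in> carrier (Fa_Sym n)" for x
    using that
    by (auto simp: defs F_mult F_one perm_action_id sym_group_mult sym_group_one)
  show "\<exists>y\<in>carrier (Fa_Sym n). y \<otimes>\<^bsub>Fa_Sym n\<^esub> x = \<one>\<^bsub>Fa_Sym n\<^esub>"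
    if x: "x \<in> carrier (Fa_Sym n)" for x
  proof -
    obtain a s where "x = (a, s)" and a: "a \<in> carrier (Fa n)" and s: "s \<in> carrier (sym_group n)"
      using x by (auto simp: defs)
    define t where "t = inv\<^bsub>sym_group n\<^esub> s"
    have t: "t \<in> carrier (sym_group n)" "t \<otimes>\<^bsub>sym_group n\<^esub> s = \<one>\<^bsub>sym_group n\<^esub>"
      unfolding t_def using s by (rule S.inv_closed, rule S.l_inv)
    define b where "b = inv\<^bsub>Fa n\<^esub> (perm_action t a)"
    have "perm_action t a \<in> carrier (Fa n)" using t(1) a by (rule perm_action_closed)
    then have "b \<in> carrier (Fa n)" "b \<otimes>\<^bsub>Fa n\<^esub> perm_action t a = \<one>\<^bsub>Fa n\<^esub>"
      unfolding b_def by (rule F.inv_closed, rule F.l_inv)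
    then show ?thesis
      using t \<open>x = (a, s)\<close> by (intro bexI[of _ "(b, t)"]) (simp_all add: defs)
  qed
qed

end

theory Submission
  imports Defs "HOL-Algebra.Multiplicative_Group" "HOL-Computational_Algebra.Primes"
begin

text \<open>
  Let \<open>G\<close> be a finite group of class two with derived subgroup \<open>D\<close>, which is central. The idea is to give \<open>G\<close> a
  second, commutative operation that turns it into a left brace: an abelian group on which \<open>G\<close> acts by
  automorphisms \<open>\<alpha>\<close> with \<open>a + \<alpha> a b = a b\<close>.

  For a group of odd order one would set \<open>a + b = a b [a,b]\<^bsup>-1/2\<^esup>\<close>. In general the square root of the commutator is
  replaced by a pairing \<open>\<beta>\<close> on \<open>G/D\<close> with values in \<open>D\<close> whose antisymmetrisation is the commutator, that is
  \<open>\<beta> a b = [a,b] \<cdot> \<beta> b a\<close>. On a product of cyclic groups any alternating pairing \<open>\<omega>\<close> is of this form: keep the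
  part of its matrix on one side of the diagonal. This is \<open>alternating_pairing_is_commutator_of_pairing\<close>, and
  it rests on splitting cyclic factors off a finite abelian group (\<open>cyclic_direct_factor\<close>). With \<open>\<beta>\<close> at hand
  the operation \<open>a + b = a b (\<beta> a b)\<inverse>\<close> has all the required properties (\<open>IYB_group_of_finite\<close>).

  A left brace is turned into the permutation data that define an IYB group in \<open>left_brace_imp_IYB_group\<close>. One
  permutes a finite set on which \<open>G\<close> acts faithfully and which maps equivariantly onto the additive group;
  the homomorphism that this map induces on the free abelian group carries the cocycle identity
  \<open>a + \<alpha> a b = a b\<close> over to the subgroup property of the graph.
\<close>

section \<open>Splitting a cyclic factor off a finite abelian group\<close>

lemma (in comm_group) ord_mult_coprime:
  assumes "x \<in> carrier G" "y \<in> carrier G" "coprime (ord x) (ord y)"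
  shows "ord (x \<otimes> y) = ord x * ord y"
proof (rule dvd_antisym)
  show "ord (x \<otimes> y) dvd ord x * ord y"
    using assms by (simp add: abelian_ord_mul_divides)
  have half: "ord u dvd ord (u \<otimes> v)"
    if u: "u \<in> carrier G" and v: "v \<in> carrier G" and cop: "coprime (ord u) (ord v)" for u v
  proof -
    have "u [^] (ord (u \<otimes> v) * ord v) = (u [^] ord (u \<otimes> v)) [^] ord v"
      using u by (simp add: nat_pow_pow)
    also have "\<dots> = (u [^] ord (u \<otimes> v)) [^] ord v \<otimes> (v [^] ord v) [^] ord (u \<otimes> v)"
      using u v by simp
    also have "\<dots> = ((u \<otimes> v) [^] ord (u \<otimes> v)) [^] ord v"
      using u v by (simp add: nat_pow_distrib nat_pow_pow mult.commute[of "ord v"] del: pow_ord_eq_1)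
    also have "\<dots> = \<one>" using u v by simp
    finally have "ord u dvd ord (u \<otimes> v) * ord v" using u by (simp add: pow_eq_id)
    then show ?thesis using cop by (simp add: coprime_dvd_mult_left_iff)
  qed
  have "ord y dvd ord (x \<otimes> y)"
    using half[of y x] assms by (simp add: m_comm coprime_commute)
  then show "ord x * ord y dvd ord (x \<otimes> y)"
    using half[of x y] assms by (simp add: divides_mult)
qed

text \<open>
  An element of maximal order works: if the order of \<open>y\<close> did not divide that of \<open>x\<close>, some prime \<open>p\<close> would
  occur in it with a larger exponent, and a product of a power of \<open>x\<close> of order prime to \<open>p\<close> with a power of
  \<open>y\<close> of \<open>p\<close>-power order would have an order larger than that of \<open>x\<close>.
\<close>

lemma (in comm_group) exists_ord_eq_exponent:
  assumes fin: "finite (carrier G)"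
  obtains x where "x \<in> carrier G" "\<And>y. y \<in> carrier G \<Longrightarrow> ord y dvd ord x"
proof -
  have "finite (ord ` carrier G)" "ord ` carrier G \<noteq> {}" using fin by auto
  then obtain x where x: "x \<in> carrier G" and max: "\<And>y. y \<in> carrier G \<Longrightarrow> ord y \<le> ord x"
    by (metis (no_types, lifting) Max_ge Max_in imageE imageI)
  have "ord y dvd ord x" if y: "y \<in> carrier G" for y
  proof (rule ccontr)
    assume "\<not> ord y dvd ord x"
    have pos: "ord x > 0" "ord y > 0" using ord_ge_1[OF fin] x y by fastforce+
    obtain p where p: "prime p" "multiplicity p (ord x) < multiplicity p (ord y)"
      using multiplicity_le_imp_dvd[of "ord y" "ord x"] pos \<open>\<not> ord y dvd ord x\<close>
      by (metis gr_implies_not0 not_le)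
    define a b where "a = multiplicity p (ord x)" and "b = multiplicity p (ord y)"
    obtain n where n: "ord x = p ^ a * n" "\<not> p dvd n"
      using multiplicity_decompose'[of "ord x" p] pos p unfolding a_def by (metis not_prime_unit neq0_conv)
    obtain m where m: "ord y = p ^ b * m"
      using multiplicity_dvd[of p "ord y"] unfolding b_def by (auto elim: dvdE)
    have nz: "p ^ a \<noteq> 0" "m \<noteq> 0" using pos n m by auto
    \<comment> \<open>Trading the \<open>p\<close>-part of \<open>x\<close> for the larger \<open>p\<close>-part of \<open>y\<close> increases the order.\<close>
    have ox: "ord (x [^] (p ^ a)) = n" using x n nz by (subst ord_pow) auto
    have oy: "ord (y [^] m) = p ^ b" using y m nz by (subst ord_pow) auto
    have "coprime n (p ^ b)"
      using p n by (metis coprime_commute coprime_power_right_iff prime_imp_coprime)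
    then have "ord (x [^] (p ^ a) \<otimes> y [^] m) = n * p ^ b"
      using ord_mult_coprime[of "x [^] (p ^ a)" "y [^] m"] x y ox oy by simp
    then have "n * p ^ b \<le> p ^ a * n" using max x y n(1) by (metis m_closed nat_pow_closed)
    moreover have "p ^ a < p ^ b"
      using p(2) prime_gt_1_nat[OF p(1)] unfolding a_def b_def by (rule power_strict_increasing)
    ultimately show False using n pos by (auto simp: mult.commute)
  qed
  with x show ?thesis by (rule that)
qed

text \<open>
  Take \<open>x\<close> whose order is the exponent of the group and \<open>B\<close> maximal among the subgroups that meet \<open>\<langle>x\<rangle>\<close>
  trivially. If \<open>y\<close> lay outside \<open>H = \<langle>x\<rangle>B\<close>, let \<open>k\<close> be the order of \<open>y\<close> modulo \<open>H\<close>. Because the order of \<open>x\<close>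
  kills \<open>y\<close>, the element \<open>y\<close> can be corrected by a power of \<open>x\<close> to some \<open>z\<close> with \<open>z\<^sup>k \<in> B\<close>, and then
  \<open>\<langle>z\<rangle>B\<close> is a larger subgroup that still meets \<open>\<langle>x\<rangle>\<close> trivially.
\<close>

lemma (in comm_group) cyclic_direct_factor:
  assumes fin: "finite (carrier G)" and nontriv: "carrier G \<noteq> {\<one>}"
  obtains x B where "x \<in> carrier G" "x \<noteq> \<one>" "subgroup B G"
    "\<And>k::int. x [^] k \<in> B \<Longrightarrow> x [^] k = \<one>"
    "\<And>a. a \<in> carrier G \<Longrightarrow> \<exists>k::int. \<exists>b\<in>B. a = x [^] k \<otimes> b"
proof -
  obtain x where x: "x \<in> carrier G" and expo: "\<And>y. y \<in> carrier G \<Longrightarrow> ord y dvd ord x"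
    using exists_ord_eq_exponent[OF fin] by blast
  define \<B> where "\<B> = {B. subgroup B G \<and> (\<forall>k::int. x [^] k \<in> B \<longrightarrow> x [^] k = \<one>)}"
  have "finite \<B>"
    by (rule finite_subset[of _ "Pow (carrier G)"]) (auto simp: \<B>_def fin dest: subgroup.subset)
  moreover have "{\<one>} \<in> \<B>" unfolding \<B>_def using triv_subgroup by auto
  ultimately obtain B where B: "B \<in> \<B>" and Bmax: "\<And>B'. B' \<in> \<B> \<Longrightarrow> B \<subseteq> B' \<Longrightarrow> B = B'"
    using finite_has_maximal[of \<B>] by blast
  have sB: "subgroup B G" and Bx: "\<And>k::int. x [^] k \<in> B \<Longrightarrow> x [^] k = \<one>"
    using B unfolding \<B>_def by auto
  note Bc = subgroup.mem_carrier[OF sB]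
  define C where "C = range (\<lambda>k::int. x [^] k)"
  define H where "H = C <#> B"
  have sC: "subgroup C G"
    using generate_pow[OF x] generate_is_subgroup[of "{x}"] x unfolding C_def full_SetCompr_eq[symmetric] by simp
  have sH: "subgroup H G" unfolding H_def by (rule mult_subgroups[OF sC sB])
  have H_iff: "a \<in> H \<longleftrightarrow> (\<exists>k::int. \<exists>b\<in>B. a = x [^] k \<otimes> b)" for a
    unfolding H_def C_def set_mult_def by auto
  have BH: "B \<subseteq> H"
  proof
    fix b assume "b \<in> B"
    then have "b = x [^] (0::int) \<otimes> b" using Bc by simp
    then show "b \<in> H" using \<open>b \<in> B\<close> H_iff by blast
  qed
  have xH: "x [^] (k::int) \<in> H" for k
  proof -
    have "x [^] k = x [^] k \<otimes> \<one>" using x by simp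
    then show ?thesis using subgroup.one_closed[OF sB] H_iff by blast
  qed
  have "H = carrier G"
  proof (rule ccontr)
    assume "H \<noteq> carrier G"
    then obtain y where y: "y \<in> carrier G" "y \<notin> H" using subgroup.subset[OF sH] by blast
    define k where "k = (LEAST k. k > 0 \<and> y [^] (k::nat) \<in> H)"
    have "ord y > 0 \<and> y [^] ord y \<in> H"
      using ord_ge_1[OF fin y(1)] y subgroup.one_closed[OF sH] by simp
    then have k: "k > 0" "y [^] k \<in> H" unfolding k_def by (metis (mono_tags, lifting) LeastI)+
    have kmin: "\<not> (j > 0 \<and> y [^] j \<in> H)" if "j < k" for j
      using that unfolding k_def by (rule not_less_Least)
    \<comment> \<open>The exponents of \<open>y\<close> that lead into \<open>H\<close> form the ideal generated by \<open>k\<close>.\<close>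
    have kdvd: "int k dvd s" if s: "y [^] s \<in> H" for s :: int
    proof (rule ccontr)
      assume nd: "\<not> int k dvd s"
      define r where "r = nat (s mod int k)"
      have r: "int r = s mod int k" using k unfolding r_def by simp
      have "r > 0" using nd r by (cases "r = 0") (auto simp: dvd_eq_mod_eq_0)
      have "int r < int k" unfolding r using k by simp
      then have "r < k" by simp
      have "y [^] r = y [^] (s - int k * (s div int k))"
        using r by (simp add: minus_mult_div_eq_mod flip: int_pow_int)
      also have "\<dots> = y [^] s \<otimes> inv ((y [^] k) [^] (s div int k))"
        using y by (simp add: int_pow_diff int_pow_pow flip: int_pow_int)
      also have "\<dots> \<in> H"
        using s k sH by (simp add: subgroup.m_closed subgroup.m_inv_closed subgroup_int_pow_closed)
      finally show False using kmin \<open>r > 0\<close> \<open>r < k\<close> by blast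
    qed
    obtain t :: int and b where b: "b \<in> B" and yk: "y [^] k = x [^] t \<otimes> b" using k H_iff by blast
    have oxpos: "ord x > 0" using ord_ge_1[OF fin x] by simp
    have y1: "y [^] ord x = \<one>" using expo y by (simp add: pow_eq_id)
    then have "int k dvd int (ord x)"
      using kdvd[of "int (ord x)"] subgroup.one_closed[OF sH] by (simp add: int_pow_int)
    then obtain l where l: "ord x = k * l" by (auto elim: dvdE)
    have "l > 0" using l oxpos by simp
    \<comment> \<open>As \<open>y\<close> is killed by the order of \<open>x\<close>, the \<open>x\<close>-part of \<open>y\<^sup>k\<close> is a \<open>k\<close>-th power.\<close>
    have "x [^] (t * int l) = (x [^] t) [^] l"
      using x by (simp add: int_pow_pow flip: int_pow_int[of G "x [^] t"])
    then have "x [^] (t * int l) \<otimes> b [^] l = (y [^] k) [^] l"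
      using x b Bc by (simp add: yk nat_pow_distrib)
    also have "\<dots> = \<one>" using y y1 l by (simp add: nat_pow_pow)
    finally have "x [^] (t * int l) \<otimes> b [^] l = \<one>" .
    then have "x [^] (t * int l) = inv (b [^] l)"
      using x b Bc by (simp add: inv_equality)
    moreover have "b [^] l \<in> B" using b sB by (metis subgroup_int_pow_closed int_pow_int)
    ultimately have "x [^] (t * int l) \<in> B" using sB by (simp add: subgroup.m_inv_closed)
    then have "x [^] (t * int l) = \<one>" by (rule Bx)
    then have "int (k * l) dvd t * int l" using x l by (simp add: int_pow_eq_id)
    then have "int k dvd t" using \<open>l > 0\<close> by simp
    then obtain u where u: "t = u * int k" by (metis dvdE mult.commute)
    \<comment> \<open>The corrected element, congruent to \<open>y\<close> modulo \<open>\<langle>x\<rangle>\<close>.\<close>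
    define z where "z = y \<otimes> x [^] (- u)"
    have z: "z \<in> carrier G" unfolding z_def using x y by simp
    have yz: "y = x [^] u \<otimes> z"
      unfolding z_def using x y by (simp add: int_pow_neg m_comm m_lcomm)
    have zk: "z [^] k = b"
    proof -
      have "x [^] t \<otimes> z [^] k = y [^] k"
        unfolding yz u using x z
        by (simp add: nat_pow_distrib flip: int_pow_pow int_pow_int[of G "x [^] u"])
      then show ?thesis using yk x z b Bc by simp
    qed
    define D where "D = range (\<lambda>k::int. z [^] k)"
    have sD: "subgroup D G"
      using generate_pow[OF z] generate_is_subgroup[of "{z}"] z unfolding D_def full_SetCompr_eq[symmetric] by simp
    have "D <#> B \<in> \<B>"
      unfolding \<B>_def
    proof (intro CollectI conjI allI impI)
      show "subgroup (D <#> B) G" by (rule mult_subgroups[OF sD sB])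
      fix i :: int assume "x [^] i \<in> D <#> B"
      then obtain s :: int and c where c: "c \<in> B" and xi: "x [^] i = z [^] s \<otimes> c"
        unfolding D_def set_mult_def by auto
      have "y [^] s = x [^] (u * s) \<otimes> z [^] s"
        unfolding yz using x z by (simp add: int_pow_distrib int_pow_pow)
      also have "z [^] s = x [^] i \<otimes> inv c"
        using xi x z c Bc by (simp add: m_assoc)
      finally have "y [^] s \<in> H"
        using xH c BH sH by (auto simp: subgroup.m_closed subgroup.m_inv_closed)
      then obtain v where v: "s = int k * v" using kdvd by (auto elim: dvdE)
      have "z [^] s = (z [^] int k) [^] v" using z by (simp add: v int_pow_pow)
      then have "z [^] s = b [^] v" by (simp add: int_pow_int zk)
      then have "x [^] i \<in> B"
        using xi b c sB by (simp add: subgroup.m_closed subgroup_int_pow_closed)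
      then show "x [^] i = \<one>" by (rule Bx)
    qed
    moreover have "B \<subseteq> D <#> B"
    proof
      fix c assume "c \<in> B"
      then have "c = z [^] (0::int) \<otimes> c" using Bc by simp
      then show "c \<in> D <#> B" using \<open>c \<in> B\<close> unfolding D_def set_mult_def by blast
    qed
    ultimately have "B = D <#> B" by (rule Bmax)
    moreover have "z \<in> D <#> B"
    proof -
      have "z = z [^] (1::int) \<otimes> \<one>" using z by simp
      then show ?thesis using subgroup.one_closed[OF sB] unfolding D_def set_mult_def by blast
    qed
    ultimately have "z \<in> H" using BH by blast
    then have "y \<in> H" unfolding yz using xH sH by (simp add: subgroup.m_closed)
    then show False using y by blast
  qed
  moreover have "x \<noteq> \<one>"
  proof
    assume "x = \<one>"
    then have "y = \<one>" if "y \<in> carrier G" for y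
      using expo[OF that] that ord_eq_1 by (metis ord_id nat_dvd_1_iff_1)
    then show False using nontriv by auto
  qed
  ultimately show ?thesis using that[of x B] x sB Bx H_iff by blast
qed

text \<open>
  The direct factor in the form used below: \<open>q\<close> is the projection onto the complement of \<open>\<langle>x\<rangle>\<close>.
\<close>

lemma (in comm_group) cyclic_kernel_endomorphism:
  assumes fin: "finite (carrier G)" and nontriv: "carrier G \<noteq> {\<one>}"
  obtains x q where "x \<in> carrier G" "x \<noteq> \<one>" "q \<in> hom G G" "q x = \<one>"
    "\<And>a. a \<in> carrier G \<Longrightarrow> \<exists>k::int. a = x [^] k \<otimes> q a"
proof -
  obtain x B where x: "x \<in> carrier G" "x \<noteq> \<one>" and sB: "subgroup B G"
    and Bx: "\<And>k::int. x [^] k \<in> B \<Longrightarrow> x [^] k = \<one>"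
    and dec: "\<And>a. a \<in> carrier G \<Longrightarrow> \<exists>k::int. \<exists>b\<in>B. a = x [^] k \<otimes> b"
    using cyclic_direct_factor[OF assms] by metis
  note Bc = subgroup.mem_carrier[OF sB]
  define q where "q a = (SOME b. b \<in> B \<and> (\<exists>k::int. a = x [^] k \<otimes> b))" for a
  have q: "q a \<in> B \<and> (\<exists>k::int. a = x [^] k \<otimes> q a)" if "a \<in> carrier G" for a
    unfolding q_def by (rule someI_ex) (use dec[OF that] in blast)
  have q_eq: "q (x [^] k \<otimes> b) = b" if b: "b \<in> B" for k :: int and b
  proof -
    have "x [^] k \<otimes> b \<in> carrier G" using x b Bc by simp
    with q obtain j :: int where c: "q (x [^] k \<otimes> b) \<in> B"
      and j: "x [^] k \<otimes> b = x [^] j \<otimes> q (x [^] k \<otimes> b)" by blast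
    define c where "c = q (x [^] k \<otimes> b)"
    have cB: "c \<in> B" and j: "x [^] k \<otimes> b = x [^] j \<otimes> c" using c j unfolding c_def by auto
    have cc: "c \<in> carrier G" "b \<in> carrier G" using cB b Bc by auto
    have "c = inv (x [^] j) \<otimes> (x [^] k \<otimes> b)" using j x cc by (simp add: inv_solve_left)
    then have c_eq: "c = x [^] (k - j) \<otimes> b" using x cc by (simp add: int_pow_diff m_ac)
    then have "x [^] (k - j) = c \<otimes> inv b" using x cc by (simp add: inv_solve_right)
    then have "x [^] (k - j) \<in> B" using cB b sB by (simp add: subgroup.m_closed subgroup.m_inv_closed)
    then have "x [^] (k - j) = \<one>" by (rule Bx)
    then show ?thesis using c_eq cc unfolding c_def by simp
  qed
  show ?thesis
  proof (rule that)
    show "x \<in> carrier G" "x \<noteq> \<one>" by fact+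
    show "q \<in> hom G G"
    proof (rule homI)
      fix a c assume ac: "a \<in> carrier G" "c \<in> carrier G"
      then obtain k l :: int where kl: "a = x [^] k \<otimes> q a" "c = x [^] l \<otimes> q c" using q by blast
      have B: "q a \<in> B" "q c \<in> B" using q ac by auto
      have "a \<otimes> c = (x [^] k \<otimes> q a) \<otimes> (x [^] l \<otimes> q c)" using kl by simp
      also have "\<dots> = x [^] (k + l) \<otimes> (q a \<otimes> q c)"
        using x B Bc by (simp add: int_pow_mult m_ac)
      finally have "a \<otimes> c = x [^] (k + l) \<otimes> (q a \<otimes> q c)" .
      then show "q (a \<otimes> c) = q a \<otimes> q c" using q_eq B sB by (simp add: subgroup.m_closed)
    qed (use q Bc in blast)
    show "q x = \<one>"
      using q_eq[of \<one> 1] x subgroup.one_closed[OF sB] by simp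
    show "\<exists>k::int. a = x [^] k \<otimes> q a" if "a \<in> carrier G" for a using q[OF that] by blast
  qed
qed

section \<open>Pairings and antisymmetrisation\<close>

definition pairing :: "('a, 'b) monoid_scheme \<Rightarrow> ('c, 'd) monoid_scheme \<Rightarrow> ('a \<Rightarrow> 'a \<Rightarrow> 'c) \<Rightarrow> bool"
  where "pairing A C f \<longleftrightarrow>
    (\<forall>a\<in>carrier A. f a \<in> hom A C) \<and> (\<forall>b\<in>carrier A. (\<lambda>a. f a b) \<in> hom A C)"

lemma pairingI:
  assumes "\<And>a b. a \<in> carrier A \<Longrightarrow> b \<in> carrier A \<Longrightarrow> f a b \<in> carrier C"
    and "\<And>a b c. a \<in> carrier A \<Longrightarrow> b \<in> carrier A \<Longrightarrow> c \<in> carrier A \<Longrightarrow>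
           f a (b \<otimes>\<^bsub>A\<^esub> c) = f a b \<otimes>\<^bsub>C\<^esub> f a c"
    and "\<And>a b c. a \<in> carrier A \<Longrightarrow> b \<in> carrier A \<Longrightarrow> c \<in> carrier A \<Longrightarrow>
           f (a \<otimes>\<^bsub>A\<^esub> b) c = f a c \<otimes>\<^bsub>C\<^esub> f b c"
  shows "pairing A C f"
  using assms unfolding pairing_def hom_def by auto

lemma pairingD:
  assumes "pairing A C f" "a \<in> carrier A" "b \<in> carrier A"
  shows "f a b \<in> carrier C"
    and "c \<in> carrier A \<Longrightarrow> f a (b \<otimes>\<^bsub>A\<^esub> c) = f a b \<otimes>\<^bsub>C\<^esub> f a c"
    and "c \<in> carrier A \<Longrightarrow> f (a \<otimes>\<^bsub>A\<^esub> b) c = f a c \<otimes>\<^bsub>C\<^esub> f b c"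
  using assms unfolding pairing_def by (auto simp: hom_def)

lemma pairing_one:
  assumes "group A" "group C" "pairing A C f" "a \<in> carrier A"
  shows "f a \<one>\<^bsub>A\<^esub> = \<one>\<^bsub>C\<^esub>" and "f \<one>\<^bsub>A\<^esub> a = \<one>\<^bsub>C\<^esub>"
  using assms hom_one[of "f a" A C] hom_one[of "\<lambda>b. f b a" A C] unfolding pairing_def by auto

lemma alternating_pairing_cyclic:
  assumes "group A" "group C" "pairing A C f" "x \<in> carrier A" "f x x = \<one>\<^bsub>C\<^esub>"
  shows "f (x [^]\<^bsub>A\<^esub> (k::int)) (x [^]\<^bsub>A\<^esub> (l::int)) = \<one>\<^bsub>C\<^esub>"
proof -
  interpret A: group A by fact
  interpret C: group C by fact
  have p: "x [^]\<^bsub>A\<^esub> k \<in> carrier A" using assms by simp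
  have hr: "f (x [^]\<^bsub>A\<^esub> k) \<in> hom A C" and hl: "(\<lambda>a. f a x) \<in> hom A C"
    using assms(3,4) p unfolding pairing_def by auto
  have "f (x [^]\<^bsub>A\<^esub> k) x = f x x [^]\<^bsub>C\<^esub> k"
    using hom_int_pow[OF hl assms(4) assms(1,2)] by simp
  moreover have "f (x [^]\<^bsub>A\<^esub> k) (x [^]\<^bsub>A\<^esub> l) = f (x [^]\<^bsub>A\<^esub> k) x [^]\<^bsub>C\<^esub> l"
    by (rule hom_int_pow[OF hr assms(4) assms(1,2)])
  ultimately show ?thesis using assms(5) by simp
qed

text \<open>
  If the group is a direct product of cyclic groups with generators \<open>x\<^sub>1, \<dots>, x\<^sub>r\<close>, the pairing that agrees with
  \<open>\<omega>\<close> on \<open>(x\<^sub>i, x\<^sub>j)\<close> for \<open>i > j\<close> and is trivial on the other pairs of generators has the required property;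
  it is well defined because \<open>\<omega>\<close> respects the orders of the generators. The induction below produces it one
  cyclic factor at a time: with \<open>p a \<in> \<langle>x\<rangle>\<close> and \<open>q a\<close> the components of \<open>a\<close>, and \<open>\<gamma>\<close> a solution on the
  complement, put \<open>\<beta> a b = \<omega> (q a) (p b) \<cdot> \<gamma> (q a) (q b)\<close>. No square root of \<open>\<omega>\<close> is taken, so groups of
  even order are covered.
\<close>

theorem alternating_pairing_is_commutator_of_pairing:
  assumes "comm_group A" "finite (carrier A)" "comm_group C" "pairing A C \<omega>"
    and "\<And>a. a \<in> carrier A \<Longrightarrow> \<omega> a a = \<one>\<^bsub>C\<^esub>"
  shows "\<exists>\<beta>. pairing A C \<beta> \<and>
    (\<forall>a\<in>carrier A. \<forall>b\<in>carrier A. \<beta> a b = \<omega> a b \<otimes>\<^bsub>C\<^esub> \<beta> b a)"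
  using assms
proof (induction "card (carrier A)" arbitrary: A rule: less_induct)
  case less
  interpret A: comm_group A by fact
  interpret C: comm_group C by fact
  note \<omega> = pairingD[OF less.prems(4)] and alt = less.prems(5)
  show ?case
  proof (cases "carrier A = {\<one>\<^bsub>A\<^esub>}")
    case True
    have "pairing A C (\<lambda>_ _. \<one>\<^bsub>C\<^esub>)" by (rule pairingI) auto
    moreover have "\<omega> \<one>\<^bsub>A\<^esub> \<one>\<^bsub>A\<^esub> = \<one>\<^bsub>C\<^esub>" using alt by simp
    ultimately show ?thesis using True by (intro exI[of _ "\<lambda>_ _. \<one>\<^bsub>C\<^esub>"]) auto
  next
    case False
    obtain x q where x: "x \<in> carrier A" "x \<noteq> \<one>\<^bsub>A\<^esub>" and q: "q \<in> hom A A" and qx: "q x = \<one>\<^bsub>A\<^esub>"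
      and dec: "\<And>a. a \<in> carrier A \<Longrightarrow> \<exists>k::int. a = x [^]\<^bsub>A\<^esub> k \<otimes>\<^bsub>A\<^esub> q a"
      using A.cyclic_kernel_endomorphism[OF less.prems(2) False] by metis
    have qc[simp]: "q a \<in> carrier A" if "a \<in> carrier A" for a
      using q that by (auto simp: hom_def)
    have qm[simp]: "q (a \<otimes>\<^bsub>A\<^esub> b) = q a \<otimes>\<^bsub>A\<^esub> q b" if "a \<in> carrier A" "b \<in> carrier A" for a b
      using q that by (auto simp: hom_def)
    define p where "p a = a \<otimes>\<^bsub>A\<^esub> inv\<^bsub>A\<^esub> q a" for a
    have pc[simp]: "p a \<in> carrier A" if "a \<in> carrier A" for a
      unfolding p_def using that by simp
    have pm[simp]: "p (a \<otimes>\<^bsub>A\<^esub> b) = p a \<otimes>\<^bsub>A\<^esub> p b" if "a \<in> carrier A" "b \<in> carrier A" for a b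
      unfolding p_def using that by (simp add: A.inv_mult A.m_ac)
    have pq: "p a \<otimes>\<^bsub>A\<^esub> q a = a" if "a \<in> carrier A" for a
      unfolding p_def using that by (simp add: A.m_assoc)
    have pk: "\<exists>k::int. p a = x [^]\<^bsub>A\<^esub> k" if "a \<in> carrier A" for a
    proof -
      obtain k :: int where "a = x [^]\<^bsub>A\<^esub> k \<otimes>\<^bsub>A\<^esub> q a" using dec \<open>a \<in> carrier A\<close> by blast
      then have "p a = x [^]\<^bsub>A\<^esub> k"
        unfolding p_def using that x A.inv_solve_right[of "x [^]\<^bsub>A\<^esub> k" a "q a"] by simp
      then show ?thesis by blast
    qed
    \<comment> \<open>An alternating pairing is trivial on a cyclic subgroup.\<close>
    have pp: "\<omega> (p a) (p b) = \<one>\<^bsub>C\<^esub>" if ab: "a \<in> carrier A" "b \<in> carrier A" for a b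
    proof -
      obtain k :: int where "p a = x [^]\<^bsub>A\<^esub> k" using pk[OF ab(1)] by (elim exE)
      moreover obtain l :: int where "p b = x [^]\<^bsub>A\<^esub> l" using pk[OF ab(2)] by (elim exE)
      ultimately show ?thesis
        using alternating_pairing_cyclic[OF A.group_axioms C.group_axioms less.prems(4) x(1) alt[OF x(1)]]
        by simp
    qed
    have anti: "\<omega> a b \<otimes>\<^bsub>C\<^esub> \<omega> b a = \<one>\<^bsub>C\<^esub>" if ab: "a \<in> carrier A" "b \<in> carrier A" for a b
    proof -
      have "\<one>\<^bsub>C\<^esub> = \<omega> (a \<otimes>\<^bsub>A\<^esub> b) (a \<otimes>\<^bsub>A\<^esub> b)" using ab alt by simp
      also have "\<dots> = \<omega> a b \<otimes>\<^bsub>C\<^esub> \<omega> b a" using ab \<omega> by (simp add: alt[OF ab(1)] alt[OF ab(2)] C.m_comm)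
      finally show ?thesis by simp
    qed
    define B where "B = A\<lparr>carrier := q ` carrier A\<rparr>"
    interpret q: group_hom A A q using q by unfold_locales
    have sub: "subgroup (q ` carrier A) A" by (rule q.img_is_subgroup)
    have B: "comm_group B" 
      unfolding B_def using A.m_comm qc
      by (intro group.group_comm_groupI[OF A.subgroup_imp_group[OF sub]]) auto
    have cB: "carrier B = q ` carrier A" and mB: "(\<otimes>\<^bsub>B\<^esub>) = (\<otimes>\<^bsub>A\<^esub>)" unfolding B_def by auto
    have "\<not> inj_on q (carrier A)" using x qx by (metis A.one_closed inj_onD q.hom_one)
    then have "card (carrier B) < card (carrier A)"
      unfolding cB using less.prems(2) card_image_le eq_card_imp_inj_on le_neq_implies_less by blast
    moreover have "finite (carrier B)" using less.prems(2) unfolding cB by simp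
    moreover have "pairing B C \<omega>" by (rule pairingI) (auto simp: cB mB \<omega>)
    moreover have "\<omega> a a = \<one>\<^bsub>C\<^esub>" if "a \<in> carrier B" for a using that alt unfolding cB by auto
    ultimately obtain \<gamma> where \<gamma>: "pairing B C \<gamma>"
      and \<gamma>\<omega>: "\<And>a b. a \<in> carrier B \<Longrightarrow> b \<in> carrier B \<Longrightarrow> \<gamma> a b = \<omega> a b \<otimes>\<^bsub>C\<^esub> \<gamma> b a"
      using less.hyps[OF _ B] less.prems(3) by blast
    have qB: "q a \<in> carrier B" if "a \<in> carrier A" for a using that unfolding cB by blast
    note \<gamma> = pairingD[OF \<gamma>, unfolded mB]
    define \<beta> where "\<beta> a b = \<omega> (q a) (p b) \<otimes>\<^bsub>C\<^esub> \<gamma> (q a) (q b)" for a b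
    have "pairing A C \<beta>"
      by (rule pairingI) (simp_all add: \<beta>_def \<omega> \<gamma> qB C.m_ac)
    moreover have "\<beta> a b = \<omega> a b \<otimes>\<^bsub>C\<^esub> \<beta> b a" if ab: "a \<in> carrier A" "b \<in> carrier A" for a b
    proof -
      have "\<omega> a b = \<omega> (p a \<otimes>\<^bsub>A\<^esub> q a) (p b \<otimes>\<^bsub>A\<^esub> q b)" using ab by (simp add: pq)
      also have "\<dots> = \<omega> (p a) (q b) \<otimes>\<^bsub>C\<^esub> \<omega> (q a) (p b) \<otimes>\<^bsub>C\<^esub> \<omega> (q a) (q b)"
        using ab by (simp add: \<omega> pp C.m_ac)
      finally have "\<omega> a b \<otimes>\<^bsub>C\<^esub> \<beta> b a =
          (\<omega> (p a) (q b) \<otimes>\<^bsub>C\<^esub> \<omega> (q b) (p a)) \<otimes>\<^bsub>C\<^esub>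
          (\<omega> (q a) (p b) \<otimes>\<^bsub>C\<^esub> (\<omega> (q a) (q b) \<otimes>\<^bsub>C\<^esub> \<gamma> (q b) (q a)))"
        unfolding \<beta>_def using ab by (simp add: \<omega> \<gamma> qB C.m_ac)
      then show ?thesis
        unfolding \<beta>_def using ab anti[of "p a" "q b"] \<gamma>\<omega>[of "q a" "q b"] by (simp add: \<omega> \<gamma> qB)
    qed
    ultimately show ?thesis by blast
  qed
qed

section \<open>Commutators in groups of class two\<close>

definition commutator :: "('a, 'b) monoid_scheme \<Rightarrow> 'a \<Rightarrow> 'a \<Rightarrow> 'a"
  where "commutator G a b = a \<otimes>\<^bsub>G\<^esub> b \<otimes>\<^bsub>G\<^esub> inv\<^bsub>G\<^esub> a \<otimes>\<^bsub>G\<^esub> inv\<^bsub>G\<^esub> b"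

context group
begin

lemma commutator_closed: "a \<in> carrier G \<Longrightarrow> b \<in> carrier G \<Longrightarrow> commutator G a b \<in> carrier G"
  unfolding commutator_def by simp

lemma commutator_in_derived:
  "a \<in> carrier G \<Longrightarrow> b \<in> carrier G \<Longrightarrow> commutator G a b \<in> derived G (carrier G)"
  unfolding commutator_def derived_def by (intro generate.incl) blast

text \<open>
  Identities between commutators are verified below by rewriting products, without inverses.
\<close>

lemma commutator_unique:
  assumes "a \<in> carrier G" "b \<in> carrier G" "c \<in> carrier G"
  shows "commutator G a b = c \<longleftrightarrow> a \<otimes> b = c \<otimes> (b \<otimes> a)"
proof -
  have "commutator G a b = (a \<otimes> b) \<otimes> inv (b \<otimes> a)"
    unfolding commutator_def using assms by (simp add: inv_mult_group m_assoc)
  then show ?thesis using assms inv_solve_right'[of c "a \<otimes> b" "b \<otimes> a"]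
    by (metis inv_solve_right m_closed)
qed

lemma commutator_swap:
  assumes "a \<in> carrier G" "b \<in> carrier G"
  shows "a \<otimes> b = commutator G a b \<otimes> (b \<otimes> a)"
  using commutator_unique commutator_closed assms by blast

lemma commutator_self: "a \<in> carrier G \<Longrightarrow> commutator G a a = \<one>"
  by (simp add: commutator_unique)

end

locale class_two_group = group +
  assumes derived_central: "\<lbrakk>d \<in> derived G (carrier G); g \<in> carrier G\<rbrakk> \<Longrightarrow> d \<otimes> g = g \<otimes> d"
begin

abbreviation D :: "'a set" where "D \<equiv> derived G (carrier G)"

lemma D_subgroup: "subgroup D G"
  by (rule derived_is_subgroup) simp

lemma D_carrier: "d \<in> D \<Longrightarrow> d \<in> carrier G"
  using subgroup.mem_carrier[OF D_subgroup] .

lemma commutator_mult_left: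
  assumes "a \<in> carrier G" "b \<in> carrier G" "c \<in> carrier G"
  shows "commutator G (a \<otimes> b) c = commutator G a c \<otimes> commutator G b c"
proof -
  note cl = commutator_closed
  let ?u = "commutator G a c" and ?v = "commutator G b c"
  have "a \<otimes> b \<otimes> c = a \<otimes> (?v \<otimes> (c \<otimes> b))"
    using assms commutator_swap[of b c] by (simp add: m_assoc)
  also have "\<dots> = ?v \<otimes> a \<otimes> (c \<otimes> b)"
    using assms derived_central[OF commutator_in_derived, of b c a] by (simp add: cl flip: m_assoc)
  also have "\<dots> = ?v \<otimes> (a \<otimes> c) \<otimes> b" using assms by (simp add: cl m_assoc)
  also have "\<dots> = ?v \<otimes> (?u \<otimes> (c \<otimes> a)) \<otimes> b" using assms commutator_swap[of a c] by simp
  also have "\<dots> = (?v \<otimes> ?u) \<otimes> (c \<otimes> (a \<otimes> b))" using assms by (simp add: cl m_assoc)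
  also have "?v \<otimes> ?u = ?u \<otimes> ?v" using assms by (intro derived_central commutator_in_derived cl)
  finally show ?thesis using assms by (simp add: commutator_unique cl)
qed

lemma commutator_mult_right:
  assumes "a \<in> carrier G" "b \<in> carrier G" "c \<in> carrier G"
  shows "commutator G a (b \<otimes> c) = commutator G a b \<otimes> commutator G a c"
proof -
  note cl = commutator_closed
  let ?u = "commutator G a b" and ?v = "commutator G a c"
  have "a \<otimes> (b \<otimes> c) = ?u \<otimes> (b \<otimes> a) \<otimes> c"
    using assms commutator_swap[of a b] by (simp flip: m_assoc)
  also have "\<dots> = ?u \<otimes> (b \<otimes> (a \<otimes> c))" using assms by (simp add: cl m_assoc)
  also have "\<dots> = ?u \<otimes> ((b \<otimes> ?v) \<otimes> (c \<otimes> a))" 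
    using assms commutator_swap[of a c] by (simp add: cl m_assoc)
  also have "b \<otimes> ?v = ?v \<otimes> b"
    by (rule derived_central[OF commutator_in_derived[OF assms(1,3)] assms(2), symmetric])
  also have "?u \<otimes> (?v \<otimes> b \<otimes> (c \<otimes> a)) = (?u \<otimes> ?v) \<otimes> (b \<otimes> c \<otimes> a)"
    using assms by (simp add: cl m_assoc)
  finally show ?thesis using assms by (simp add: commutator_unique cl)
qed

lemma commutator_derived:
  assumes "d \<in> D" "a \<in> carrier G"
  shows "commutator G d a = \<one>" "commutator G a d = \<one>"
  using assms derived_central[OF assms] by (simp_all add: commutator_unique D_carrier)

text \<open>
  The commutator of a class two group depends only on the classes of its arguments modulo the derived subgroup
  \<open>D\<close>, hence is an alternating pairing on the abelian group \<open>G/D\<close> with values in \<open>D\<close>. The wanted pairing is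
  inflated from \<open>G/D\<close>, which is why it vanishes on \<open>D\<close>.
\<close>

lemma exists_pairing_with_commutator:
  assumes fin: "finite (carrier G)"
  obtains b where "pairing G (G\<lparr>carrier := D\<rparr>) b"
    "\<And>a c. a \<in> carrier G \<Longrightarrow> c \<in> carrier G \<Longrightarrow> b a c = commutator G a c \<otimes> b c a"
    "\<And>a d. a \<in> carrier G \<Longrightarrow> d \<in> D \<Longrightarrow> b a d = \<one>"
    "\<And>a d. a \<in> carrier G \<Longrightarrow> d \<in> D \<Longrightarrow> b d a = \<one>"
proof -
  interpret D: normal D G by (rule derived_self_is_normal)
  let ?A = "G Mod D" and ?C = "G\<lparr>carrier := D\<rparr>"
  interpret A: comm_group ?A by (rule derived_quot_is_comm_group)
  have C: "comm_group ?C"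
    by (intro group.group_comm_groupI[OF subgroup_imp_group[OF D_subgroup]])
      (auto simp: derived_central D_carrier)
  interpret C: comm_group ?C by (rule C)
  have cA: "carrier ?A = (\<lambda>a. D #> a) ` carrier G"
    unfolding FactGroup_def RCOSETS_def by auto
  define r where "r X = (SOME g. g \<in> X)" for X :: "'a set"
  have r: "\<exists>d\<in>D. r (D #> a) = d \<otimes> a" if a: "a \<in> carrier G" for a
  proof -
    have "a \<in> D #> a" using rcos_self[OF a D_subgroup] .
    then have "r (D #> a) \<in> D #> a" unfolding r_def by (rule someI)
    then show ?thesis unfolding r_coset_def by auto
  qed
  define \<omega> where "\<omega> X Y = commutator G (r X) (r Y)" for X Y
  have \<omega>_eq: "\<omega> (D #> a) (D #> c) = commutator G a c" if ac: "a \<in> carrier G" "c \<in> carrier G" for a c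
  proof -
    obtain d d' where "r (D #> a) = d \<otimes> a" "d \<in> D" "r (D #> c) = d' \<otimes> c" "d' \<in> D"
      using r ac by metis
    then show ?thesis unfolding \<omega>_def using ac
      by (simp add: commutator_mult_left commutator_mult_right commutator_derived D_carrier commutator_closed)
  qed
  have "pairing ?A ?C \<omega>"
    by (rule pairingI)
      (auto simp: cA \<omega>_eq commutator_in_derived D.rcos_sum commutator_mult_left commutator_mult_right)
  moreover have "\<omega> X X = \<one>\<^bsub>?C\<^esub>" if "X \<in> carrier ?A" for X
    using that unfolding cA by (auto simp: \<omega>_eq commutator_self)
  moreover have "finite (carrier ?A)" using fin unfolding cA by simp
  ultimately obtain \<beta> where \<beta>: "pairing ?A ?C \<beta>"
    and anti: "\<And>X Y. X \<in> carrier ?A \<Longrightarrow> Y \<in> carrier ?A \<Longrightarrow> \<beta> X Y = \<omega> X Y \<otimes>\<^bsub>?C\<^esub> \<beta> Y X"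
    using alternating_pairing_is_commutator_of_pairing[OF A.comm_group_axioms _ C, of \<omega>] by metis
  note \<beta>' = pairingD[OF \<beta>, unfolded cA]
  have Dd: "D #> d = \<one>\<^bsub>?A\<^esub>" if "d \<in> D" for d
    using coset_join2[OF D_carrier[OF that] D_subgroup that] by simp
  show ?thesis
  proof (rule that[of "\<lambda>a c. \<beta> (D #> a) (D #> c)"])
    show "pairing G ?C (\<lambda>a c. \<beta> (D #> a) (D #> c))"
      by (rule pairingI) (use \<beta>' in \<open>simp_all flip: D.rcos_sum\<close>)
    show "\<beta> (D #> a) (D #> c) = commutator G a c \<otimes> \<beta> (D #> c) (D #> a)"
      if "a \<in> carrier G" "c \<in> carrier G" for a c
      using anti[of "D #> a" "D #> c"] \<omega>_eq[OF that] that unfolding cA by simp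
    show "\<beta> (D #> a) (D #> d) = \<one>" "\<beta> (D #> d) (D #> a) = \<one>"
      if "a \<in> carrier G" "d \<in> D" for a d
      using pairing_one[OF A.group_axioms C.group_axioms \<beta>, of "D #> a"] Dd[OF that(2)] that
      unfolding cA by simp_all
  qed
qed

end

section \<open>From left braces to IYB groups\<close>

lemma perm_action_diff: "perm_action \<sigma> (a - b) = perm_action \<sigma> a - perm_action \<sigma> b"
  by (simp add: perm_action_def frag_extend_diff)

text \<open>
  A second, commutative group structure \<open>P\<close> on the carrier of \<open>G\<close>, on which \<open>G\<close> acts through \<open>\<alpha>\<close> with
  \<open>a + \<alpha> a b = a b\<close>, makes \<open>G\<close> a left brace. The identity says that the identity map \<open>G \<rightarrow> P\<close> is a bijective
  \<open>1\<close>-cocycle; that \<open>\<alpha>\<close> is multiplicative follows from it by comparing \<open>(a b) c\<close> with \<open>a (b c)\<close>.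

  Let \<open>G\<close> permute a finite set \<open>X\<close> faithfully, and let \<open>X \<rightarrow> P\<close> be a surjective equivariant map. It extends
  to an equivariant surjective homomorphism \<open>\<pi>\<close> from the free abelian group on \<open>X\<close> to \<open>P\<close>. Letting \<open>\<phi> f\<close> be
  the permutation by which \<open>\<pi> f\<close> acts on \<open>X\<close>, the cocycle identity becomes
  \<open>\<pi> (f + \<phi> f \<cdot> h) = \<pi> f \<cdot> \<pi> h\<close>; this is closure of the graph of \<open>\<phi>\<close> under the multiplication of the
  semidirect product, and the image of \<open>\<phi>\<close> is a copy of \<open>G\<close>.
\<close>

lemma left_brace_imp_IYB_group:
  fixes G :: "('a, 'b) monoid_scheme" and P :: "('a, 'c) monoid_scheme"
  assumes "group G" and fin: "finite (carrier G)"
    and "comm_group P" and cP: "carrier P = carrier G"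
    and hom: "\<And>a. a \<in> carrier G \<Longrightarrow> \<alpha> a \<in> hom P P"
    and brace: "\<And>a b. a \<in> carrier G \<Longrightarrow> b \<in> carrier G \<Longrightarrow> a \<otimes>\<^bsub>P\<^esub> \<alpha> a b = a \<otimes>\<^bsub>G\<^esub> b"
  shows "IYB_group G"
proof -
  interpret G: group G by fact
  interpret P: comm_group P by fact
  note [simp] = cP
  have lc[simp]: "\<alpha> a b \<in> carrier G" if "a \<in> carrier G" "b \<in> carrier G" for a b
    using hom[OF that(1)] that(2) by (auto simp: hom_def)
  have Pc[simp]: "a \<otimes>\<^bsub>P\<^esub> b \<in> carrier G" if "a \<in> carrier G" "b \<in> carrier G" for a b
    using P.m_closed that by simp
  have Pinv[simp]: "inv\<^bsub>P\<^esub> a \<in> carrier G" if "a \<in> carrier G" for a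
    using P.inv_closed that by simp
  have ladd: "\<alpha> a (b \<otimes>\<^bsub>P\<^esub> c) = \<alpha> a b \<otimes>\<^bsub>P\<^esub> \<alpha> a c"
    if "a \<in> carrier G" "b \<in> carrier G" "c \<in> carrier G" for a b c
    using hom[OF that(1)] that(2,3) by (auto simp: hom_def)
  have lmult: "\<alpha> (a \<otimes>\<^bsub>G\<^esub> b) c = \<alpha> a (\<alpha> b c)"
    if [simp]: "a \<in> carrier G" "b \<in> carrier G" "c \<in> carrier G" for a b c
  proof -
    have "(a \<otimes>\<^bsub>G\<^esub> b) \<otimes>\<^bsub>P\<^esub> \<alpha> (a \<otimes>\<^bsub>G\<^esub> b) c = a \<otimes>\<^bsub>G\<^esub> (b \<otimes>\<^bsub>P\<^esub> \<alpha> b c)"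
      by (simp add: brace G.m_assoc)
    also have "\<dots> = a \<otimes>\<^bsub>P\<^esub> (\<alpha> a b \<otimes>\<^bsub>P\<^esub> \<alpha> a (\<alpha> b c))"
      by (subst brace[symmetric]) (simp_all add: ladd)
    also have "\<dots> = (a \<otimes>\<^bsub>G\<^esub> b) \<otimes>\<^bsub>P\<^esub> \<alpha> a (\<alpha> b c)"
      by (simp add: P.m_assoc flip: brace[of a b])
    finally show ?thesis by simp
  qed
  have lone: "\<alpha> \<one>\<^bsub>G\<^esub> c = c" if c: "c \<in> carrier G" for c
  proof -
    have "\<alpha> \<one>\<^bsub>G\<^esub> (\<alpha> \<one>\<^bsub>G\<^esub> c) = \<alpha> \<one>\<^bsub>G\<^esub> c" using lmult[of "\<one>\<^bsub>G\<^esub>" "\<one>\<^bsub>G\<^esub>" c] c by simp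
    then have "\<one>\<^bsub>G\<^esub> \<otimes>\<^bsub>P\<^esub> \<alpha> \<one>\<^bsub>G\<^esub> c = \<one>\<^bsub>G\<^esub> \<otimes>\<^bsub>P\<^esub> \<alpha> \<one>\<^bsub>G\<^esub> (\<alpha> \<one>\<^bsub>G\<^esub> c)" by simp
    then have "\<one>\<^bsub>G\<^esub> \<otimes>\<^bsub>G\<^esub> c = \<one>\<^bsub>G\<^esub> \<otimes>\<^bsub>G\<^esub> \<alpha> \<one>\<^bsub>G\<^esub> c"
      by (simp only: brace[OF G.one_closed c] brace[OF G.one_closed lc[OF G.one_closed c]])
    then show ?thesis using c by simp
  qed
  have one_eq: "\<one>\<^bsub>P\<^esub> = \<one>\<^bsub>G\<^esub>"
    using brace[of "\<one>\<^bsub>G\<^esub>" "\<one>\<^bsub>P\<^esub>"] lone[of "\<one>\<^bsub>P\<^esub>"] P.one_closed by simp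

  \<comment> \<open>The action \<open>\<alpha>\<close> on \<open>P\<close> may have a kernel, for instance when \<open>G\<close> is abelian and \<open>\<alpha>\<close> trivial. The second
    factor, the regular action, makes the action on \<open>X\<close> faithful; the first projection is still equivariant.\<close>
  define X where "X = carrier G \<times> carrier G"
  define act where "act g x = (\<alpha> g (fst x), g \<otimes>\<^bsub>G\<^esub> snd x)" for g x
  define n where "n = card X"
  have finX: "finite X" using fin unfolding X_def by simp
  obtain e where e: "bij_betw e {1..n} X"
    using ex_bij_betw_nat_finite_1[OF finX] unfolding n_def by blast
  define d where "d = inv_into {1..n} e"
  have d: "d x \<in> {1..n}" "e (d x) = x" if "x \<in> X" for x
    using e that unfolding d_def
    by (metis bij_betw_imp_surj_on inv_into_into, metis bij_betw_inv_into_right)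
  have de: "d (e i) = i" if "i \<in> {1..n}" for i
    using e that unfolding d_def by (rule bij_betw_inv_into_left)
  have eX: "e i \<in> X" if "i \<in> {1..n}" for i using e that by (auto simp: bij_betw_def)
  have "(\<one>\<^bsub>G\<^esub>, \<one>\<^bsub>G\<^esub>) \<in> X" unfolding X_def by simp
  then have npos: "n > 0" unfolding n_def using finX by (auto simp: card_gt_0_iff)

  have act_X: "act g x \<in> X" if "g \<in> carrier G" "x \<in> X" for g x
    using that unfolding act_def X_def by auto
  have act_mult: "act (g \<otimes>\<^bsub>G\<^esub> h) x = act g (act h x)"
    if "g \<in> carrier G" "h \<in> carrier G" "x \<in> X" for g h x
    using that unfolding act_def X_def by (auto simp: lmult G.m_assoc)
  have act_one: "act \<one>\<^bsub>G\<^esub> x = x" if "x \<in> X" for x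
    using that unfolding act_def X_def by (auto simp: lone)

  \<comment> \<open>The action on \<open>X\<close>, transported to the numbers \<open>1, \<dots>, n\<close> by the enumeration \<open>e\<close> with inverse \<open>d\<close>.\<close>
  define \<rho> where "\<rho> g i = (if i \<in> {1..n} then d (act g (e i)) else i)" for g i
  have \<rho>_mult: "\<rho> (g \<otimes>\<^bsub>G\<^esub> h) = \<rho> g \<circ> \<rho> h" if "g \<in> carrier G" "h \<in> carrier G" for g h
  proof
    fix i show "\<rho> (g \<otimes>\<^bsub>G\<^esub> h) i = (\<rho> g \<circ> \<rho> h) i"
      using that d[OF act_X[OF that(2) eX]] unfolding \<rho>_def by (auto simp: act_mult eX simp del: atLeastAtMost_iff)
  qed
  have \<rho>_one: "\<rho> \<one>\<^bsub>G\<^esub> = id"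
    unfolding \<rho>_def by (auto simp: fun_eq_iff act_one eX de simp del: atLeastAtMost_iff)
  have \<rho>_in: "\<rho> g i \<in> {1..n}" if "g \<in> carrier G" "i \<in> {1..n}" for g i
    using that d act_X eX unfolding \<rho>_def by simp
  have e_\<rho>: "e (\<rho> g i) = act g (e i)" if "g \<in> carrier G" "i \<in> {1..n}" for g i
    using that d act_X eX unfolding \<rho>_def by simp
  have \<rho>_sym: "\<rho> g \<in> carrier (sym_group n)" if g: "g \<in> carrier G" for g
    unfolding sym_group_carrier
  proof (rule bij_imp_permutes)
    have "\<rho> g (\<rho> (inv\<^bsub>G\<^esub> g) i) = i" "\<rho> (inv\<^bsub>G\<^esub> g) (\<rho> g i) = i" for i
      using g \<rho>_one \<rho>_mult[of g "inv\<^bsub>G\<^esub> g"] \<rho>_mult[of "inv\<^bsub>G\<^esub> g" g] by (auto simp: fun_eq_iff)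
    then show "bij_betw (\<rho> g) {1..n} {1..n}"
      using g by (intro bij_betw_byWitness[where f' = "\<rho> (inv\<^bsub>G\<^esub> g)"]) (auto simp: \<rho>_in simp del: atLeastAtMost_iff One_nat_def)
    show "\<rho> g i = i" if "i \<notin> {1..n}" for i using that unfolding \<rho>_def by (rule if_not_P)
  qed
  have \<rho>_inj: "inj_on \<rho> (carrier G)"
  proof (rule inj_onI)
    fix g h assume gh: "g \<in> carrier G" "h \<in> carrier G" "\<rho> g = \<rho> h"
    define i where "i = d (\<one>\<^bsub>G\<^esub>, \<one>\<^bsub>G\<^esub>)"
    have i: "i \<in> {1..n}" "e i = (\<one>\<^bsub>G\<^esub>, \<one>\<^bsub>G\<^esub>)"
      using d \<open>(\<one>\<^bsub>G\<^esub>, \<one>\<^bsub>G\<^esub>) \<in> X\<close> unfolding i_def by auto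
    have "act g (e i) = act h (e i)" using gh e_\<rho> i by metis
    then show "g = h" using gh i by (simp add: act_def)
  qed

  have "(\<lambda>i. fst (e i)) ` {1..n} \<subseteq> carrier P" using eX unfolding X_def by fastforce
  then obtain \<pi> where \<pi>: "\<pi> \<in> hom (free_Abelian_group {1..n}) P"
    and \<pi>_of: "\<And>i. i \<in> {1..n} \<Longrightarrow> \<pi> (frag_of i) = fst (e i)"
    using P.free_Abelian_group_universal[of "\<lambda>i. fst (e i)" "{1..n}"] by blast
  have \<pi>': "\<pi> \<in> hom (Fa n) P" using \<pi> by (simp add: Fa_def)
  have \<pi>c[simp]: "\<pi> f \<in> carrier G" if "f \<in> carrier (Fa n)" for f
    using \<pi>' that by (auto simp: hom_def)
  have Fa_mult: "f \<otimes>\<^bsub>Fa n\<^esub> h = f + h" and Fa_one: "\<one>\<^bsub>Fa n\<^esub> = 0" for f h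
    by (simp_all add: Fa_def)
  interpret F: group "Fa n" by (simp add: Fa_def)
  have \<pi>_add: "\<pi> (f + h) = \<pi> f \<otimes>\<^bsub>P\<^esub> \<pi> h" if "f \<in> carrier (Fa n)" "h \<in> carrier (Fa n)" for f h
    using \<pi>' that by (auto simp: hom_def Fa_mult)
  have \<pi>_zero: "\<pi> 0 = \<one>\<^bsub>P\<^esub>"
    using hom_one[OF \<pi>' F.group_axioms P.group_axioms] by (simp add: Fa_one)
  have F_diff: "f - h \<in> carrier (Fa n)" if "f \<in> carrier (Fa n)" "h \<in> carrier (Fa n)" for f h
    using that keys_diff[of f h] by (auto simp: Fa_def)
  have \<pi>_diff: "\<pi> (f - h) = \<pi> f \<otimes>\<^bsub>P\<^esub> inv\<^bsub>P\<^esub> \<pi> h"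
    if fh: "f \<in> carrier (Fa n)" "h \<in> carrier (Fa n)" for f h
  proof -
    have "\<pi> f = \<pi> (f - h) \<otimes>\<^bsub>P\<^esub> \<pi> h" using \<pi>_add[OF F_diff[OF fh] fh(2)] by simp
    then show ?thesis
      using fh F_diff[OF fh] by (subst P.inv_solve_right) auto
  qed
  have \<pi>_surj: "\<pi> ` carrier (Fa n) = carrier G"
  proof
    show "carrier G \<subseteq> \<pi> ` carrier (Fa n)"
    proof
      fix g assume "g \<in> carrier G"
      then have "(g, \<one>\<^bsub>G\<^esub>) \<in> X" unfolding X_def by simp
      then have "g = \<pi> (frag_of (d (g, \<one>\<^bsub>G\<^esub>)))" "d (g, \<one>\<^bsub>G\<^esub>) \<in> {1..n}" using \<pi>_of d by auto
      then show "g \<in> \<pi> ` carrier (Fa n)" by (auto simp: Fa_def)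
    qed
  qed auto
  have \<pi>_equiv: "\<pi> (perm_action (\<rho> g) f) = \<alpha> g (\<pi> f)"
    if g: "g \<in> carrier G" and f: "f \<in> carrier (Fa n)" for g f
  proof -
    interpret L: group_hom P P "\<alpha> g" using hom[OF g] by unfold_locales
    have "Poly_Mapping.keys f \<subseteq> {1..n}" using f by (simp add: Fa_def)
    then have "f \<in> carrier (Fa n) \<and> \<pi> (perm_action (\<rho> g) f) = \<alpha> g (\<pi> f)"
    proof (induction f rule: frag_induction)
      case zero
      show ?case by (simp add: \<pi>_zero perm_action_def Fa_def)
    next
      case (one i)
      have "\<pi> (frag_of (\<rho> g i)) = fst (act g (e i))"
        using \<pi>_of[OF \<rho>_in[OF g one]] e_\<rho>[OF g one] by simp
      then show ?case
        using one \<pi>_of[OF one] by (simp add: perm_action_basis act_def Fa_def)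
    next
      case (diff a b)
      then show ?case
        using F_diff[of a b] \<pi>_diff[of a b] perm_action_closed[OF \<rho>_sym[OF g]]
          \<pi>_diff[of "perm_action (\<rho> g) a" "perm_action (\<rho> g) b"]
        by (simp add: perm_action_diff)
    qed
    then show ?thesis by blast
  qed
  define \<phi> where "\<phi> f = \<rho> (\<pi> f)" for f
  have \<phi>_sym: "\<phi> f \<in> carrier (sym_group n)" if "f \<in> carrier (Fa n)" for f
    unfolding \<phi>_def using that by (simp add: \<rho>_sym)
  have cocycle: "\<pi> (f + perm_action (\<phi> f) h) = \<pi> f \<otimes>\<^bsub>G\<^esub> \<pi> h"
    if "f \<in> carrier (Fa n)" "h \<in> carrier (Fa n)" for f h
    using that perm_action_closed[OF \<phi>_sym[OF that(1)] that(2)] unfolding \<phi>_def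
    by (simp add: \<pi>_add \<pi>_equiv brace)
  interpret S: group "Fa_Sym n" by (rule Fa_Sym_group)
  have S_mult: "(f, s) \<otimes>\<^bsub>Fa_Sym n\<^esub> (h, t) = (f + perm_action s h, s \<circ> t)" for f s h t
    by (simp add: Fa_Sym_def semidirect_product_def Fa_mult sym_group_mult)
  have S_one: "\<one>\<^bsub>Fa_Sym n\<^esub> = (0, id)"
    by (simp add: Fa_Sym_def semidirect_product_def Fa_one sym_group_one)
  have S_carrier: "carrier (Fa_Sym n) = carrier (Fa n) \<times> carrier (sym_group n)"
    by (simp add: Fa_Sym_def semidirect_product_def)
  let ?\<Gamma> = "{(f, \<phi> f) | f. f \<in> carrier (Fa n)}"
  have closed: "f + perm_action (\<phi> f) h \<in> carrier (Fa n)"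
    if "f \<in> carrier (Fa n)" "h \<in> carrier (Fa n)" for f h
    using F.m_closed[OF that(1) perm_action_closed[OF \<phi>_sym[OF that(1)] that(2)]] by (simp add: Fa_mult)
  have "subgroup ?\<Gamma> (Fa_Sym n)"
  proof (rule S.subgroupI)
    show "?\<Gamma> \<subseteq> carrier (Fa_Sym n)" using \<phi>_sym by (auto simp: S_carrier)
    show "?\<Gamma> \<noteq> {}" using F.one_closed by blast
  next
    fix u v assume "u \<in> ?\<Gamma>" "v \<in> ?\<Gamma>"
    then obtain f h where "u = (f, \<phi> f)" "v = (h, \<phi> h)"
      and fh: "f \<in> carrier (Fa n)" "h \<in> carrier (Fa n)" by auto
    then have "u \<otimes>\<^bsub>Fa_Sym n\<^esub> v = (f + perm_action (\<phi> f) h, \<phi> f \<circ> \<phi> h)" by (simp add: S_mult)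
    also have "\<phi> f \<circ> \<phi> h = \<phi> (f + perm_action (\<phi> f) h)"
      using fh cocycle[OF fh] by (simp add: \<phi>_def \<rho>_mult)
    finally show "u \<otimes>\<^bsub>Fa_Sym n\<^esub> v \<in> ?\<Gamma>" using closed[OF fh] by blast
  next
    fix u assume "u \<in> ?\<Gamma>"
    then obtain f where u: "u = (f, \<phi> f)" and f: "f \<in> carrier (Fa n)" by auto
    \<comment> \<open>The solution of \<open>f + \<phi> f \<cdot> h = 0\<close>.\<close>
    define h where "h = perm_action (\<rho> (inv\<^bsub>G\<^esub> \<pi> f)) (0 - f)"
    have h: "h \<in> carrier (Fa n)"
      unfolding h_def using f F_diff[OF F.one_closed f] by (simp add: perm_action_closed \<rho>_sym Fa_one)
    have sum: "f + perm_action (\<phi> f) h = 0"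
      unfolding h_def \<phi>_def using f
      by (simp add: \<rho>_one perm_action_id flip: perm_action_comp \<rho>_mult)
    have "\<pi> f \<otimes>\<^bsub>G\<^esub> \<pi> h = \<one>\<^bsub>G\<^esub>" using cocycle[OF f h] sum by (simp add: \<pi>_zero one_eq)
    then have "\<phi> f \<circ> \<phi> h = id"
      unfolding \<phi>_def using f h by (simp add: \<rho>_one flip: \<rho>_mult)
    then have "(f, \<phi> f) \<otimes>\<^bsub>Fa_Sym n\<^esub> (h, \<phi> h) = \<one>\<^bsub>Fa_Sym n\<^esub>" by (simp add: S_mult S_one sum)
    then have "inv\<^bsub>Fa_Sym n\<^esub> (h, \<phi> h) = (f, \<phi> f)"
      using f h \<phi>_sym by (intro S.inv_equality) (auto simp: S_carrier)
    then have "inv\<^bsub>Fa_Sym n\<^esub> u = (h, \<phi> h)"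
      unfolding u using h \<phi>_sym by (metis S.inv_inv S_carrier SigmaI)
    then show "inv\<^bsub>Fa_Sym n\<^esub> u \<in> ?\<Gamma>" using h by blast
  qed
  moreover have "G \<cong> (sym_group n)\<lparr>carrier := \<phi> ` carrier (Fa n)\<rparr>"
  proof -
    have "\<phi> ` carrier (Fa n) = \<rho> ` carrier G"
      unfolding \<pi>_surj[symmetric] by (simp add: \<phi>_def image_image)
    moreover have "\<rho> \<in> iso G ((sym_group n)\<lparr>carrier := \<rho> ` carrier G\<rparr>)"
      using \<rho>_inj \<rho>_mult by (intro isoI homI) (auto simp: bij_betw_def sym_group_mult)
    ultimately show ?thesis by (auto simp: is_iso_def)
  qed
  ultimately show ?thesis
    unfolding IYB_group_def using G.group_axioms fin npos \<phi>_sym by blast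
qed

section \<open>The brace of a group of class two\<close>

context class_two_group
begin

text \<open>
  With \<open>b\<close> the pairing just constructed, \<open>a + c = a c (b a c)\<inverse>\<close> is the brace addition. It is commutative because
  \<open>b a c\<close> and \<open>b c a\<close> differ by the commutator of \<open>a\<close> and \<open>c\<close>, and associative because \<open>b\<close> is multiplicative in
  both arguments and does not see its own central values, which makes it a \<open>2\<close>-cocycle. Solving
  \<open>a + y = a c\<close> for \<open>y\<close> forces the action \<open>y = c (b a c)\<close> of \<open>a\<close>.
\<close>

theorem IYB_group_of_finite:
  assumes fin: "finite (carrier G)"
  shows "IYB_group G"
proof -
  obtain b where b: "pairing G (G\<lparr>carrier := D\<rparr>) b"
    and swap: "\<And>a c. a \<in> carrier G \<Longrightarrow> c \<in> carrier G \<Longrightarrow> b a c = commutator G a c \<otimes> b c a"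
    and right_one: "\<And>a d. a \<in> carrier G \<Longrightarrow> d \<in> D \<Longrightarrow> b a d = \<one>"
    and left_one: "\<And>a d. a \<in> carrier G \<Longrightarrow> d \<in> D \<Longrightarrow> b d a = \<one>"
    using exists_pairing_with_commutator[OF fin] by metis
  have bD: "b a c \<in> D" if "a \<in> carrier G" "c \<in> carrier G" for a c
    using pairingD(1)[OF b that] by simp
  have bc[simp]: "b a c \<in> carrier G" if "a \<in> carrier G" "c \<in> carrier G" for a c
    using bD[OF that] by (rule D_carrier)
  have b_right: "b a (c \<otimes> e) = b a c \<otimes> b a e"
    and b_left: "b (a \<otimes> c) e = b a e \<otimes> b c e"
    if "a \<in> carrier G" "c \<in> carrier G" "e \<in> carrier G" for a c e
    using pairingD(2,3)[OF b] that by simp_all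
  have Dinv: "inv d \<in> D" if "d \<in> D" for d
    using that by (rule subgroup.m_inv_closed[OF D_subgroup])
  have central: "a \<otimes> d = d \<otimes> a" if "d \<in> D" "a \<in> carrier G" for a d
    using derived_central[OF that] by simp

  \<comment> \<open>The values of \<open>b\<close> are central; writing them in front keeps the products in a normal form.\<close>
  define add where "add a c = inv (b a c) \<otimes> (a \<otimes> c)" for a c
  define lam where "lam a c = b a c \<otimes> c" for a c
  have add_closed[simp]: "add a c \<in> carrier G" if "a \<in> carrier G" "c \<in> carrier G" for a c
    unfolding add_def using that by simp
  have lam_closed[simp]: "lam a c \<in> carrier G" if "a \<in> carrier G" "c \<in> carrier G" for a c
    unfolding lam_def using that by simp
  have b_absorb: "b a (d \<otimes> c) = b a c" "b (d \<otimes> a) c = b a c"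
    if "a \<in> carrier G" "c \<in> carrier G" "d \<in> D" for a c d
    using that by (simp_all add: b_right b_left D_carrier right_one left_one)
  have b_add: "b a (add c e) = b a c \<otimes> b a e" "b (add a c) e = b a e \<otimes> b c e"
    if "a \<in> carrier G" "c \<in> carrier G" "e \<in> carrier G" for a c e
    unfolding add_def using that by (simp_all add: b_absorb Dinv bD b_right b_left)
  have b_lam: "b a (lam c e) = b a e" if "a \<in> carrier G" "c \<in> carrier G" "e \<in> carrier G" for a c e
    unfolding lam_def using that by (simp add: b_absorb bD)

  define P where "P = \<lparr>carrier = carrier G, mult = add, one = \<one>\<rparr>"
  have "comm_group P"
  proof (rule comm_groupI)
    fix x y assume "x \<in> carrier P" "y \<in> carrier P"
    then have [simp]: "x \<in> carrier G" "y \<in> carrier G" unfolding P_def by auto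
    show "x \<otimes>\<^bsub>P\<^esub> y \<in> carrier P" unfolding P_def by simp
    have "inv (b x y) \<otimes> (commutator G x y \<otimes> (y \<otimes> x)) = inv (b y x) \<otimes> (y \<otimes> x)"
    proof -
      have "inv (b x y) = inv (b y x) \<otimes> inv (commutator G x y)"
        by (simp add: swap[of x y] inv_mult_group commutator_closed)
      then show ?thesis by (simp add: m_assoc commutator_closed inv_solve_left')
    qed
    then show "x \<otimes>\<^bsub>P\<^esub> y = y \<otimes>\<^bsub>P\<^esub> x"
      unfolding P_def add_def by (simp flip: commutator_swap)
    fix z assume "z \<in> carrier P"
    then have [simp]: "z \<in> carrier G" unfolding P_def by auto
    show "x \<otimes>\<^bsub>P\<^esub> y \<otimes>\<^bsub>P\<^esub> z = x \<otimes>\<^bsub>P\<^esub> (y \<otimes>\<^bsub>P\<^esub> z)"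
    proof -
      let ?p = "inv (b x y)" and ?q = "inv (b x z)" and ?r = "inv (b y z)"
      have "add (add x y) z = inv (b x z \<otimes> b y z) \<otimes> (?p \<otimes> (x \<otimes> y) \<otimes> z)"
        unfolding add_def[of "add x y"] b_add(2)[OF \<open>x \<in> carrier G\<close> \<open>y \<in> carrier G\<close> \<open>z \<in> carrier G\<close>]
        by (simp add: add_def)
      also have "\<dots> = (?r \<otimes> ?q \<otimes> ?p) \<otimes> (x \<otimes> y \<otimes> z)"
        by (simp add: inv_mult_group m_assoc)
      also have "?r \<otimes> ?q \<otimes> ?p = ?q \<otimes> ?p \<otimes> ?r"
        using central[of ?r "?q \<otimes> ?p"] by (simp add: Dinv bD m_assoc)
      also have "?q \<otimes> ?p \<otimes> ?r \<otimes> (x \<otimes> y \<otimes> z) = ?q \<otimes> ?p \<otimes> (?r \<otimes> x \<otimes> (y \<otimes> z))"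
        by (simp add: m_assoc)
      also have "?r \<otimes> x = x \<otimes> ?r" using central[of ?r x] by (simp add: Dinv bD)
      also have "?q \<otimes> ?p \<otimes> (x \<otimes> ?r \<otimes> (y \<otimes> z)) = inv (b x y \<otimes> b x z) \<otimes> (x \<otimes> (?r \<otimes> (y \<otimes> z)))"
        by (simp add: inv_mult_group m_assoc)
      also have "\<dots> = add x (add y z)"
        unfolding add_def[of x "add y z"] b_add(1)[OF \<open>x \<in> carrier G\<close> \<open>y \<in> carrier G\<close> \<open>z \<in> carrier G\<close>]
        by (simp add: add_def)
      finally show ?thesis unfolding P_def by simp
    qed
  next
    show "\<one>\<^bsub>P\<^esub> \<in> carrier P" unfolding P_def by simp
    fix x assume "x \<in> carrier P"
    then have x[simp]: "x \<in> carrier G" unfolding P_def by auto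
    show "\<one>\<^bsub>P\<^esub> \<otimes>\<^bsub>P\<^esub> x = x"
      unfolding P_def add_def
      using left_one[OF x subgroup.one_closed[OF D_subgroup]] by simp
    \<comment> \<open>The additive inverse is \<open>inv x\<close> up to the central factor that the cocycle contributes.\<close>
    let ?y = "b (inv x) x \<otimes> inv x"
    have "add ?y x = \<one>"
      unfolding add_def by (simp add: b_absorb bD m_assoc)
    then show "\<exists>y\<in>carrier P. y \<otimes>\<^bsub>P\<^esub> x = \<one>\<^bsub>P\<^esub>"
      unfolding P_def by (intro bexI[of _ ?y]) auto
  qed
  moreover have "lam a \<in> hom P P" if a[simp]: "a \<in> carrier G" for a
  proof (rule homI)
    fix x y assume "x \<in> carrier P" "y \<in> carrier P"
    then have [simp]: "x \<in> carrier G" "y \<in> carrier G" unfolding P_def by auto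
    have "add (lam a x) (lam a y) = inv (b (lam a x) y) \<otimes> (lam a x \<otimes> lam a y)"
      unfolding add_def by (simp add: b_lam)
    also have "b (lam a x) y = b x y" unfolding lam_def by (simp add: b_absorb bD)
    also have "lam a x \<otimes> lam a y = b a x \<otimes> (x \<otimes> b a y) \<otimes> y"
      unfolding lam_def by (simp add: m_assoc)
    also have "x \<otimes> b a y = b a y \<otimes> x" by (intro central bD) simp_all
    also have "inv (b x y) \<otimes> (b a x \<otimes> (b a y \<otimes> x) \<otimes> y) =
        inv (b x y) \<otimes> (b a x \<otimes> b a y) \<otimes> (x \<otimes> y)"
      by (simp add: m_assoc)
    also have "inv (b x y) \<otimes> (b a x \<otimes> b a y) = (b a x \<otimes> b a y) \<otimes> inv (b x y)"
      by (intro derived_central Dinv bD) simp_all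
    also have "(b a x \<otimes> b a y) \<otimes> inv (b x y) \<otimes> (x \<otimes> y) = b a (add x y) \<otimes> add x y"
      by (simp add: b_add(1)) (simp add: add_def m_assoc)
    finally show "lam a (x \<otimes>\<^bsub>P\<^esub> y) = lam a x \<otimes>\<^bsub>P\<^esub> lam a y"
      unfolding P_def by (simp add: lam_def[of a "add x y"])
  qed (simp add: P_def)
  moreover have "a \<otimes>\<^bsub>P\<^esub> lam a c = a \<otimes> c" if [simp]: "a \<in> carrier G" "c \<in> carrier G" for a c
  proof -
    have "add a (lam a c) = inv (b a c) \<otimes> (a \<otimes> b a c) \<otimes> c"
      unfolding add_def by (simp add: b_lam) (simp add: lam_def m_assoc)
    also have "a \<otimes> b a c = b a c \<otimes> a" by (intro central bD) simp_all
    also have "inv (b a c) \<otimes> (b a c \<otimes> a) \<otimes> c = a \<otimes> c" by (simp flip: m_assoc)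
    finally show ?thesis unfolding P_def by simp
  qed
  ultimately show ?thesis
    by (intro left_brace_imp_IYB_group[of G P lam]) (auto simp: fin P_def)
qed

end

text \<open>
  The first commutator term of the lower central series is the derived subgroup; triviality of the next one
  says that its elements commute with everything.
\<close>

lemma class_two_group_of_nilpotency_class_two:
  assumes "nilpotent_group G" "nilpotency_class G = 2"
  shows "class_two_group G"
proof -
  interpret group G using assms unfolding nilpotent_group_def by blast
  have "lower_central G 2 = {\<one>\<^bsub>G\<^esub>}"
    using assms LeastI_ex[of "\<lambda>k. lower_central G k = {\<one>\<^bsub>G\<^esub>}"]
    unfolding nilpotent_group_def nilpotency_class_def by auto
  then have "commutator G d g = \<one>\<^bsub>G\<^esub>" if "d \<in> lower_central G 1" "g \<in> carrier G" for d g
    using that generate.incl[of "commutator G d g"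
        "{commutator G x y | x y. x \<in> lower_central G 1 \<and> y \<in> carrier G}" G]
    by (auto simp: numeral_2_eq_2 commutator_def)
  moreover have "lower_central G 1 = derived G (carrier G)"
    unfolding derived_def One_nat_def by (auto intro!: arg_cong[of _ _ "generate G"])
  ultimately have trivial: "commutator G d g = \<one>\<^bsub>G\<^esub>"
    if "d \<in> derived G (carrier G)" "g \<in> carrier G" for d g
    using that by simp
  show ?thesis
  proof
    fix d g assume d: "d \<in> derived G (carrier G)" and g: "g \<in> carrier G"
    have "d \<in> carrier G" using d derived_in_carrier[of "carrier G"] by blast
    then show "d \<otimes>\<^bsub>G\<^esub> g = g \<otimes>\<^bsub>G\<^esub> d" using commutator_swap[of d g] trivial[OF d g] g by simp
  qed
qed

theorem corollary3p10:
  fixes G :: "('a, 'b) monoid_scheme"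
  assumes "nilpotent_group G" and "finite (carrier G)" and "nilpotency_class G = 2"
  shows "IYB_group G"
  using class_two_group.IYB_group_of_finite class_two_group_of_nilpotency_class_two assms by blast

end
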